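(* Let $n\ge 2$. (1) The number of $2$-dissections of a convex regular $n$-gon modulo the cyclic action is \[ |G(n,2)/Z_n|=\begin{cases}\frac{1}{12}n(n-2)(n-4), & n \text{ even},\\[2pt] \frac{1}{12}(n+1)(n-3)(n-4), & n\text{ odd}.\end{cases} \] (2) The number of $2$-dissections of a convex regular $n$-gon modulo the dihedral action is \[ |G(n,2)/D_{2n}|=\begin{cases}\frac{1}{24}(n-4)(n-2)(n+3), & n \text{ even},\\[2pt] \frac{1}{24}(n-3)(n^2-13), & n\text{ odd}.\end{cases} \]
   Context: A $k$-dissection of a convex regular $n$-gon is a partition of it into $k+1$ polygons by $k$ pairwise non-crossing diagonals; $G(n,k)$ is the set of $k$-dissections (vertices labelled $0,\dots,n-1$ in cyclic order), and it is empty when no such dissection exists (e.g. $G(n,2)=\emptyset$ for $n<5$). The cyclic group $Z_n$ (rotations) and the dihedral group $D_{2n}$ (symmetries of the regular $n$-gon) act on $G(n,k)$, and $G(n,k)/Z_n$, $G(n,k)/D_{2n}$ denote the sets of orbits. *)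

theory Defs
  imports Complex_Main "HOL-Algebra.Group_Action" "HOL-Algebra.Elementary_Groups"
begin

text \<open>The vertices of the \<open>n\<close>-gon are the integers \<open>0, \<dots>, n - 1\<close> in cyclic order, a diagonal is
  the two-element set of its endpoints, and a dissection is the set of its diagonals.\<close>

definition vertices :: "nat \<Rightarrow> int set" where
  "vertices n = {0..<int n}"

definition diagonals :: "nat \<Rightarrow> int set set" where
  "diagonals n = {{i, j} | i j. i \<in> vertices n \<and> j \<in> vertices n \<and> i \<noteq> j \<and>
     (i + 1) mod int n \<noteq> j \<and> (j + 1) mod int n \<noteq> i}"

text \<open>Two diagonals of a convex polygon meet in an interior point iff their endpoints interleave;
  diagonals sharing an endpoint do not cross.\<close>

definition crossing :: "int set \<Rightarrow> int set \<Rightarrow> bool" where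
  "crossing D E \<longleftrightarrow> (\<exists>a b c d. a < b \<and> b < c \<and> c < d \<and>
     (D = {a, c} \<and> E = {b, d} \<or> D = {b, d} \<and> E = {a, c}))"

definition dissections :: "nat \<Rightarrow> nat \<Rightarrow> int set set set" where
  "dissections n k = {S. S \<subseteq> diagonals n \<and> card S = k \<and> pairwise (\<lambda>D E. \<not> crossing D E) S}"

text \<open>\<open>(r, False)\<close> is the rotation \<open>i \<mapsto> r + i\<close> and \<open>(r, True)\<close> the reflection \<open>i \<mapsto> r - i\<close>, modulo
  \<open>n\<close>. The group has order \<open>2 * n\<close> for every positive \<open>n\<close>.\<close>

definition dihedral_group :: "nat \<Rightarrow> (int \<times> bool) monoid" where
  "dihedral_group n =
     \<lparr>carrier = {0..<int n} \<times> UNIV,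
      mult = (\<lambda>(r, s) (r', s'). ((if s then r - r' else r + r') mod int n, s \<noteq> s')),
      one = (0, False)\<rparr>"

definition symmetry :: "nat \<Rightarrow> int \<times> bool \<Rightarrow> int \<Rightarrow> int" where
  "symmetry n = (\<lambda>(r, s) i. (if s then r - i else r + i) mod int n)"

text \<open>The actions are restricted to the set of dissections because the library's \<open>group_action\<close>
  requires extensional bijections.\<close>

definition dihedral_action :: "nat \<Rightarrow> nat \<Rightarrow> int \<times> bool \<Rightarrow> int set set \<Rightarrow> int set set" where
  "dihedral_action n k g = (\<lambda>S \<in> dissections n k. (`) (symmetry n g) ` S)"

definition cyclic_action :: "nat \<Rightarrow> nat \<Rightarrow> int \<Rightarrow> int set set \<Rightarrow> int set set" where
  "cyclic_action n k r = dihedral_action n k (r, False)"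

lemma finite_dissections: "finite (dissections n k)"
proof -
  have "diagonals n \<subseteq> Pow (vertices n)"
    by (auto simp: diagonals_def)
  then have "finite (diagonals n)"
    by (rule finite_subset) (simp add: vertices_def)
  then show ?thesis
    by (auto simp: dissections_def intro: finite_subset[of _ "Pow (diagonals n)"])
qed

lemma group_dihedral_group:
  assumes "n > 0"
  shows "group (dihedral_group n)"
proof (rule groupI)
  fix x assume x: "x \<in> carrier (dihedral_group n)"
  obtain r s where rs: "x = (r, s)" by force
  show "\<exists>y\<in>carrier (dihedral_group n). y \<otimes>\<^bsub>dihedral_group n\<^esub> x = \<one>\<^bsub>dihedral_group n\<^esub>"
    using assms x unfolding rs
    by (intro bexI[of _ "(if s then r else (- r) mod int n, s)"])
       (auto simp: dihedral_group_def mod_add_left_eq)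
qed (use assms in \<open>auto simp: dihedral_group_def mod_simps algebra_simps\<close>)

lemma symmetry_cases:
  assumes "0 \<le> r" "r < int n" "i \<in> vertices n"
  shows "symmetry n (r, False) i = (if r + i < int n then r + i else r + i - int n)"
    and "symmetry n (r, True) i = (if i \<le> r then r - i else r - i + int n)"
proof -
  have "(r + i) mod int n = r + i - int n" if "\<not> r + i < int n"
    using assms that mod_pos_pos_trivial[of "r + i - int n" "int n"]
    by (simp add: vertices_def)
  then show "symmetry n (r, False) i = (if r + i < int n then r + i else r + i - int n)"
    using assms by (auto simp: symmetry_def vertices_def)
  have "(r - i) mod int n = r - i + int n" if "\<not> i \<le> r"
    using assms that by (subst mod_add_self2[symmetric], subst mod_pos_pos_trivial)
       (auto simp: vertices_def)
  then show "symmetry n (r, True) i = (if i \<le> r then r - i else r - i + int n)"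
    using assms by (auto simp: symmetry_def vertices_def)
qed

lemma symmetry_in_vertices: "n > 0 \<Longrightarrow> symmetry n g i \<in> vertices n"
  by (auto simp: symmetry_def vertices_def split: prod.splits)

lemma symmetry_mult:
  "symmetry n (g \<otimes>\<^bsub>dihedral_group n\<^esub> h) i = symmetry n g (symmetry n h i)"
  by (auto simp: symmetry_def dihedral_group_def mod_simps algebra_simps split: prod.splits)

lemma symmetry_one: "i \<in> vertices n \<Longrightarrow> symmetry n \<one>\<^bsub>dihedral_group n\<^esub> i = i"
  by (auto simp: symmetry_def dihedral_group_def vertices_def)

lemma symmetry_inv:
  assumes "n > 0" "g \<in> carrier (dihedral_group n)" "i \<in> vertices n"
  shows "symmetry n (inv\<^bsub>dihedral_group n\<^esub> g) (symmetry n g i) = i"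
  using assms
  by (simp flip: symmetry_mult add: group.l_inv[OF group_dihedral_group] symmetry_one)

lemma crossing_symmetry:
  assumes "g \<in> carrier (dihedral_group n)" "D \<subseteq> vertices n" "E \<subseteq> vertices n" "crossing D E"
  shows "crossing (symmetry n g ` D) (symmetry n g ` E)"
proof -
  have *: "crossing (symmetry n g ` {a, c}) (symmetry n g ` {b, d})"
    if "a < b" "b < c" "c < d" "{a, b, c, d} \<subseteq> vertices n" for a b c d
  proof -
    obtain r s where g: "g = (r, s)" by force
    have r: "0 \<le> r" "r < int n"
      using assms(1) by (auto simp: g dihedral_group_def)
    define f where "f = symmetry n g"
    have v: "0 \<le> a" "d < int n" using that by (auto simp: vertices_def)
    have "f a < f b \<and> f b < f c \<and> f c < f d \<or> f b < f c \<and> f c < f d \<and> f d < f a \<or>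
      f c < f d \<and> f d < f a \<and> f a < f b \<or> f d < f a \<and> f a < f b \<and> f b < f c \<or>
      f d < f c \<and> f c < f b \<and> f b < f a \<or> f c < f b \<and> f b < f a \<and> f a < f d \<or>
      f b < f a \<and> f a < f d \<and> f d < f c \<or> f a < f d \<and> f d < f c \<and> f c < f b"
    proof (cases s)
      case False
      have eq: "f x = (if r + x < int n then r + x else r + x - int n)"
        if "x \<in> vertices n" for x
        using symmetry_cases(1)[OF r that] False by (simp add: f_def g)
      consider "r + d < int n" | "r + c < int n" "\<not> r + d < int n"
        | "r + b < int n" "\<not> r + c < int n" | "r + a < int n" "\<not> r + b < int n"
        | "\<not> r + a < int n" by linarith
      then show ?thesis
        by cases (use that r v in \<open>simp_all add: eq\<close>)
    next
      case True
      have eq: "f x = (if x \<le> r then r - x else r - x + int n)" if "x \<in> vertices n" for x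
        using symmetry_cases(2)[OF r that] True by (simp add: f_def g)
      consider "d \<le> r" | "c \<le> r" "\<not> d \<le> r" | "b \<le> r" "\<not> c \<le> r" | "a \<le> r" "\<not> b \<le> r"
        | "\<not> a \<le> r" by linarith
      then show ?thesis
        by cases (use that r v in \<open>simp_all add: eq\<close>)
    qed
    moreover have "crossing {x, z} {y, w} \<and> crossing {y, w} {x, z}"
      if "x < y" "y < z" "z < w" for x y z w
      unfolding crossing_def using that by blast
    ultimately have "crossing {f a, f c} {f b, f d}"
      by (elim disjE conjE) (metis insert_commute)+
    then show ?thesis by (simp add: f_def)
  qed
  have sym: "crossing X Y \<Longrightarrow> crossing Y X" for X Y
    unfolding crossing_def by metis
  from assms(4) obtain a b c d where "a < b" "b < c" "c < d"
    and "D = {a, c} \<and> E = {b, d} \<or> D = {b, d} \<and> E = {a, c}"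
    unfolding crossing_def by blast
  then show ?thesis using *[of a b c d] sym assms(2,3) by auto
qed

lemma diagonals_symmetry:
  assumes "n > 0" "g \<in> carrier (dihedral_group n)" "D \<in> diagonals n"
  shows "symmetry n g ` D \<in> diagonals n"
proof -
  obtain i j where D: "D = {i, j}" and ij: "i \<in> vertices n" "j \<in> vertices n" "i \<noteq> j"
    "(i + 1) mod int n \<noteq> j" "(j + 1) mod int n \<noteq> i"
    using assms(3) by (auto simp: diagonals_def)
  let ?f = "symmetry n g" and ?h = "symmetry n (inv\<^bsub>dihedral_group n\<^esub> g)"
  have inj: "?f x = ?f y \<Longrightarrow> x = y" if "x \<in> vertices n" "y \<in> vertices n" for x y
    using symmetry_inv[OF assms(1,2)] that by metis
  obtain r s where g: "g = (r, s)" by force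
  have step: "(?f x + 1) mod int n = ?f ((if s then x - 1 else x + 1) mod int n)" for x
    by (auto simp: g symmetry_def mod_simps algebra_simps)
  have m: "x mod int n \<in> vertices n" for x
    using assms(1) by (auto simp: vertices_def)
  have prev: "(y + 1) mod int n = x" if "x \<in> vertices n" "y = (x - 1) mod int n" for x y
    using that by (auto simp: vertices_def mod_simps)
  have "(?f x + 1) mod int n \<noteq> ?f y"
    if "x \<in> vertices n" "y \<in> vertices n" "(x + 1) mod int n \<noteq> y" "(y + 1) mod int n \<noteq> x" for x y
  proof
    assume "(?f x + 1) mod int n = ?f y"
    then have "(if s then x - 1 else x + 1) mod int n = y"
      using inj[OF m that(2)] by (simp add: step)
    then show False using that prev[of x y] by (auto split: if_splits)
  qed
  then have "(?f i + 1) mod int n \<noteq> ?f j" "(?f j + 1) mod int n \<noteq> ?f i"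
    using ij by auto
  then show ?thesis
    using ij inj symmetry_in_vertices[OF assms(1)] unfolding diagonals_def D by blast
qed

lemma diagonals_subset_vertices: "D \<in> diagonals n \<Longrightarrow> D \<subseteq> vertices n"
  by (auto simp: diagonals_def)

lemma symmetry_image_inv:
  assumes "n > 0" "g \<in> carrier (dihedral_group n)" "D \<subseteq> vertices n"
  shows "symmetry n (inv\<^bsub>dihedral_group n\<^esub> g) ` symmetry n g ` D = D"
  using symmetry_inv[OF assms(1,2)] assms(3) by (force simp: image_image)

lemma dissections_symmetry:
  assumes n: "n > 0" and g: "g \<in> carrier (dihedral_group n)" and S: "S \<in> dissections n k"
  shows "(`) (symmetry n g) ` S \<in> dissections n k"
proof -
  let ?f = "symmetry n g" and ?h = "symmetry n (inv\<^bsub>dihedral_group n\<^esub> g)"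
  have ginv: "inv\<^bsub>dihedral_group n\<^esub> g \<in> carrier (dihedral_group n)"
    using g group.inv_closed[OF group_dihedral_group[OF n]] by blast
  have sub: "D \<subseteq> vertices n" "D \<in> diagonals n" if "D \<in> S" for D
    using S that diagonals_subset_vertices by (auto simp: dissections_def)
  have inv: "?h ` ?f ` D = D" if "D \<in> S" for D
    using symmetry_image_inv[OF n g] sub that by blast
  have "inj_on ((`) ?f) S" by (rule inj_on_inverseI[of _ "(`) ?h"]) (rule inv)
  then have "card ((`) ?f ` S) = k"
    using S by (simp add: card_image dissections_def)
  moreover have "(`) ?f ` S \<subseteq> diagonals n"
    using sub diagonals_symmetry[OF n g] by blast
  moreover have "\<not> crossing (?f ` D) (?f ` E)" if "D \<in> S" "E \<in> S" "D \<noteq> E" for D E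
  proof
    assume "crossing (?f ` D) (?f ` E)"
    then have "crossing D E"
      using crossing_symmetry[OF ginv, of "?f ` D" "?f ` E"] inv[OF that(1)] inv[OF that(2)]
        symmetry_in_vertices[OF n] by (simp add: image_subset_iff)
    then show False using S that by (auto simp: dissections_def pairwise_def)
  qed
  then have "pairwise (\<lambda>D E. \<not> crossing D E) ((`) ?f ` S)"
    by (auto simp: pairwise_def)
  ultimately show ?thesis by (simp add: dissections_def)
qed

lemma dihedral_action_closed:
  assumes "n > 0" "g \<in> carrier (dihedral_group n)" "S \<in> dissections n k"
  shows "dihedral_action n k g S \<in> dissections n k"
  using dissections_symmetry[OF assms] assms(3) by (simp add: dihedral_action_def)

lemma dihedral_action_mult:
  assumes "n > 0" "h \<in> carrier (dihedral_group n)" "S \<in> dissections n k"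
  shows "dihedral_action n k (g \<otimes>\<^bsub>dihedral_group n\<^esub> h) S =
    dihedral_action n k g (dihedral_action n k h S)"
  using dissections_symmetry[OF assms] assms(3)
  by (simp add: dihedral_action_def image_image symmetry_mult)

lemma dihedral_action_one:
  assumes "S \<in> dissections n k"
  shows "dihedral_action n k \<one>\<^bsub>dihedral_group n\<^esub> S = S"
proof -
  have "symmetry n \<one>\<^bsub>dihedral_group n\<^esub> ` D = D" if "D \<in> S" for D
    using that assms diagonals_subset_vertices[of D n] symmetry_one[of _ n]
    by (force simp: dissections_def)
  then show ?thesis using assms by (simp add: dihedral_action_def)
qed

theorem group_action_dihedral:
  assumes n: "n > 0"
  shows "group_action (dihedral_group n) (dissections n k) (dihedral_action n k)"
proof -
  let ?G = "dihedral_group n" and ?E = "dissections n k" and ?a = "dihedral_action n k"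
  interpret G: group ?G by (rule group_dihedral_group[OF n])
  have Bij: "?a g \<in> Bij ?E" if "g \<in> carrier ?G" for g
  proof -
    have "?a (inv\<^bsub>?G\<^esub> g) (?a g S) = S" "?a g (?a (inv\<^bsub>?G\<^esub> g) S) = S" if "S \<in> ?E" for S
      using that \<open>g \<in> carrier ?G\<close>
      by (simp_all flip: dihedral_action_mult[OF n] add: dihedral_action_one)
    then have "bij_betw (?a g) ?E ?E"
      using dihedral_action_closed[OF n that]
        dihedral_action_closed[OF n G.inv_closed[OF that]]
      by (intro bij_betw_byWitness[where f' = "?a (inv\<^bsub>?G\<^esub> g)"]) auto
    then show ?thesis by (simp add: Bij_def dihedral_action_def)
  qed
  have "?a (g \<otimes>\<^bsub>?G\<^esub> h) = compose ?E (?a g) (?a h)" if "h \<in> carrier ?G" for g h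
  proof
    fix S show "?a (g \<otimes>\<^bsub>?G\<^esub> h) S = compose ?E (?a g) (?a h) S"
      using dihedral_action_mult[OF n that]
      by (cases "S \<in> ?E") (auto simp: compose_def dihedral_action_def)
  qed
  then have "?a \<in> hom ?G (BijGroup ?E)"
    using Bij by (intro homI) (auto simp: BijGroup_def)
  then show ?thesis
    by (simp add: group_action_def group_hom_def group_hom_axioms_def group_BijGroup G.is_group)
qed

theorem group_action_cyclic:
  assumes n: "n > 0"
  shows "group_action (integer_mod_group n) (dissections n k) (cyclic_action n k)"
proof -
  interpret D: group_action "dihedral_group n" "dissections n k" "dihedral_action n k"
    by (rule group_action_dihedral[OF n])
  have "(\<lambda>r. (r, False)) \<in> hom (integer_mod_group n) (dihedral_group n)"
    using n by (auto simp: hom_def carrier_integer_mod_group dihedral_group_def)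
  then have "dihedral_action n k \<circ> (\<lambda>r. (r, False)) \<in>
      hom (integer_mod_group n) (BijGroup (dissections n k))"
    using D.group_hom by (auto intro: hom_compose simp: group_hom_def group_hom_axioms_def)
  then show ?thesis
    by (simp add: group_action_def group_hom_def group_hom_axioms_def group_BijGroup
        comp_def cyclic_action_def[abs_def])
qed

end

theory Submission
  imports Defs
begin

text \<open>Walking once around the polygon, a pair of non-crossing diagonals splits the boundary into four
  arcs with \<open>a, c, b, d\<close> sides, where \<open>a\<close> and \<open>b\<close> belong to the two diagonals. Up to rotation the
  dissection is determined by \<open>(a, c, b, d)\<close>, and the only ambiguity is the choice of the first
  diagonal, which exchanges \<open>(a, c, b, d)\<close> with \<open>(b, d, a, c)\<close>. A reflection exchanges \<open>c\<close> and \<open>d\<close>.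
  Hence the cyclic orbits correspond to the sequences with \<open>a < b\<close>, or \<open>a = b\<close> and \<open>c \<le> d\<close>, and the
  dihedral orbits to those with \<open>a \<le> b\<close> and \<open>c \<le> d\<close>. These are counted by summing over \<open>a + b\<close>.\<close>

section \<open>Gap sequences under rotation and reflection\<close>

type_synonym gaps = "nat \<times> nat \<times> nat \<times> nat"

text \<open>In \<open>(a, c, b, d)\<close> the entries \<open>a\<close> and \<open>b\<close> are the numbers of polygon sides cut off by the two
  diagonals, and \<open>c\<close> and \<open>d\<close> the numbers of sides between them; \<open>c = d = 0\<close> would make the
  diagonals coincide.\<close>

definition gap_sequences :: "nat \<Rightarrow> gaps set" where
  "gap_sequences n = {(a, c, b, d). 2 \<le> a \<and> 2 \<le> b \<and> 1 \<le> c + d \<and> a + c + b + d = n}"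

text \<open>The walk starts at the vertex \<open>r\<close>. An arbitrary integer \<open>r\<close>,
  reduced only in the endpoints, makes rotation plain addition.\<close>

definition gap_dissection :: "nat \<Rightarrow> gaps \<Rightarrow> int \<Rightarrow> int set set" where
  "gap_dissection n = (\<lambda>(a, c, b, d) r.
     {{r mod int n, (r + int a) mod int n},
      {(r + int a + int c) mod int n, (r + int a + int c + int b) mod int n}})"

fun swap_gaps :: "gaps \<Rightarrow> gaps" where
  "swap_gaps (a, c, b, d) = (b, d, a, c)"

fun flip_gaps :: "gaps \<Rightarrow> gaps" where
  "flip_gaps (a, c, b, d) = (a, d, b, c)"

lemma swap_gaps_in: "t \<in> gap_sequences n \<Longrightarrow> swap_gaps t \<in> gap_sequences n"
  by (cases t) (auto simp: gap_sequences_def)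

lemma flip_gaps_in: "t \<in> gap_sequences n \<Longrightarrow> flip_gaps t \<in> gap_sequences n"
  by (cases t) (auto simp: gap_sequences_def)

lemma gap_dissection_mod: "gap_dissection n t (r mod int n) = gap_dissection n t r"
  by (cases t) (simp add: gap_dissection_def mod_simps add.assoc)

lemma rotate_gap_dissection:
  "(`) (symmetry n (s, False)) ` gap_dissection n t r = gap_dissection n t (s + r)"
  by (cases t) (simp add: gap_dissection_def symmetry_def mod_simps add.assoc)

text \<open>Starting the walk at the second diagonal, \<open>a + c\<close> sides later, meets the
  same four endpoints after a full turn.\<close>

lemma gap_dissection_swap:
  assumes "(a, c, b, d) \<in> gap_sequences n"
  shows "gap_dissection n (b, d, a, c) (r + int a + int c) = gap_dissection n (a, c, b, d) r"
proof -
  have n: "int n = int a + int c + int b + int d"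
    using assms by (simp add: gap_sequences_def)
  have "(r + int a + int c + int b + int d) mod int n = r mod int n"
    "(r + int a + int c + int b + int d + int a) mod int n = (r + int a) mod int n"
    by (simp_all add: mod_eq_dvd_iff n ac_simps)
  then show ?thesis
    by (simp add: gap_dissection_def insert_commute)
qed

text \<open>A reflection reverses the walk: the image of \<open>r + a\<close> becomes the start, and
  the gap that preceded the first diagonal now follows it.\<close>

lemma reflect_gap_dissection:
  assumes "(a, c, b, d) \<in> gap_sequences n"
  shows "(`) (symmetry n (s, True)) ` gap_dissection n (a, c, b, d) r =
    gap_dissection n (a, d, b, c) (s - r - int a)"
proof -
  have n: "int n = int a + int c + int b + int d"
    using assms by (simp add: gap_sequences_def)
  have "(s - r - int a + int a + int d) mod int n = (s - (r + int a + int c + int b)) mod int n"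
    "(s - r - int a + int a + int d + int b) mod int n = (s - (r + int a + int c)) mod int n"
    by (simp_all add: mod_eq_dvd_iff n ac_simps)
  then show ?thesis
    by (simp add: gap_dissection_def symmetry_def mod_simps insert_commute diff_diff_eq)
qed

section \<open>Gap sequences describe exactly the 2-dissections\<close>

lemma gap_dissection_in_dissections:
  assumes "n > 0" "t \<in> gap_sequences n"
  shows "gap_dissection n t r \<in> dissections n 2"
proof -
  obtain a c b d where t: "t = (a, c, b, d)" by (cases t)
  have T: "2 \<le> a" "2 \<le> b" "1 \<le> c + d" "int n = int a + int c + int b + int d"
    using assms by (auto simp: t gap_sequences_def)
  \<comment> \<open>With start \<open>0\<close> only the last endpoint can wrap around, namely to
    \<open>0\<close> when \<open>d = 0\<close>.\<close>
  define w where "w = (if d = 0 then 0 else int a + int c + int b)"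
  have w: "(int a + int c + int b) mod int n = w"
    using T by (auto simp: w_def)
  have S: "gap_dissection n t 0 = {{0, int a}, {int a + int c, w}}"
    using T by (simp add: t gap_dissection_def w flip: w)
  have dia: "{i, j} \<in> diagonals n" if "0 \<le> i" "i + 2 \<le> j" "j < int n" "j - i + 2 \<le> int n" for i j
  proof -
    have "(i + 1) mod int n \<noteq> j"
      using that by simp
    moreover have "(j + 1) mod int n \<noteq> i"
      using that by (cases "j + 1 = int n") auto
    ultimately show ?thesis
      using that unfolding diagonals_def vertices_def
      by (intro CollectI exI[of _ i] exI[of _ j]) auto
  qed
  have "{0, int a} \<in> diagonals n"
    using T by (intro dia) auto
  moreover have "{int a + int c, w} \<in> diagonals n"
    using T dia[of "int a + int c" w] dia[of w "int a + int c"]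
    by (cases "d = 0") (auto simp: w_def insert_commute)
  moreover have "{0, int a} \<noteq> {int a + int c, w}"
    using T by (auto simp: doubleton_eq_iff w_def split: if_splits)
  moreover have "\<not> crossing {0, int a} {int a + int c, w}" "\<not> crossing {int a + int c, w} {0, int a}"
    using T by (auto simp: crossing_def doubleton_eq_iff w_def split: if_splits)
  ultimately have "gap_dissection n t 0 \<in> dissections n 2"
    by (auto simp: S dissections_def pairwise_def)
  then have "(`) (symmetry n (r mod int n, False)) ` gap_dissection n t 0 \<in> dissections n 2"
    using assms by (intro dissections_symmetry) (auto simp: dihedral_group_def)
  then show ?thesis
    by (simp add: rotate_gap_dissection gap_dissection_mod)
qed

text \<open>With endpoints ordered as \<open>i < j\<close> and \<open>k < l\<close>, not crossing
  means that the intervals are disjoint or nested, up to common endpoints.\<close>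

lemma dissection_is_gap_dissection:
  assumes "S \<in> dissections n 2"
  obtains t r where "t \<in> gap_sequences n" "S = gap_dissection n t r"
proof -
  obtain D E where S: "S = {D, E}" and DE: "D \<noteq> E" "D \<in> diagonals n" "E \<in> diagonals n"
    "\<not> crossing D E" "\<not> crossing E D"
    using assms by (auto simp: dissections_def card_2_iff pairwise_def)
  have dia: "\<exists>i j. D = {i, j} \<and> 0 \<le> i \<and> i + 2 \<le> j \<and> j < int n \<and> j - i + 2 \<le> int n"
    if D: "D \<in> diagonals n" for D
  proof -
    have *: "i + 2 \<le> j \<and> j - i + 2 \<le> int n"
      if "0 \<le> i" "i < j" "j < int n" "(i + 1) mod int n \<noteq> j" "(j + 1) mod int n \<noteq> i" for i j
    proof -
      have "i + 1 \<noteq> j" using that by auto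
      moreover have "\<not> (i = 0 \<and> j + 1 = int n)" using that by auto
      ultimately show ?thesis using that by linarith
    qed
    obtain i j where ij: "D = {i, j}" "0 \<le> i" "i < int n" "0 \<le> j" "j < int n" "i \<noteq> j"
      "(i + 1) mod int n \<noteq> j" "(j + 1) mod int n \<noteq> i"
      using D by (auto simp: diagonals_def vertices_def)
    show ?thesis
    proof (cases "i < j")
      case True
      then show ?thesis using ij *[of i j] by blast
    next
      case False
      then have "j < i" using ij by simp
      then show ?thesis using ij *[of j i] by (metis insert_commute)
    qed
  qed
  obtain i j where D: "D = {i, j}" and ij: "0 \<le> i" "i + 2 \<le> j" "j < int n" "j - i + 2 \<le> int n"
    using dia[OF DE(2)] by blast
  obtain k l where E: "E = {k, l}" and kl: "0 \<le> k" "k + 2 \<le> l" "l < int n" "l - k + 2 \<le> int n"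
    using dia[OF DE(3)] by blast
  have ne: "\<not> (i = k \<and> j = l)" using DE(1) D E by auto
  \<comment> \<open>Walk from \<open>i\<close>; the last gap leads from \<open>l\<close> around to
    \<open>i\<close> and is positive as \<open>l < n\<close>.\<close>
  have disjoint: "\<exists>t r. t \<in> gap_sequences n \<and> {{i, j}, {k, l}} = gap_dissection n t r"
    if "0 \<le> i" "i + 2 \<le> j" "j \<le> k" "k + 2 \<le> l" "l < int n" for i j k l
    using that
    by (intro exI[of _ "(nat (j - i), nat (k - j), nat (l - k), nat (int n - l + i))"] exI[of _ i])
      (auto simp: gap_sequences_def gap_dissection_def)
  \<comment> \<open>Walk from the inner diagonal; the outer one cuts off the arc from
    \<open>j\<close> around to \<open>i\<close>.\<close>
  have nested: "\<exists>t r. t \<in> gap_sequences n \<and> {{i, j}, {k, l}} = gap_dissection n t r"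
    if "0 \<le> i" "i \<le> k" "k + 2 \<le> l" "l \<le> j" "j < int n" "j - i + 2 \<le> int n"
      "\<not> (i = k \<and> j = l)" for i j k l
    using that
    by (intro exI[of _ "(nat (l - k), nat (j - l), nat (int n - j + i), nat (k - i))"] exI[of _ k])
      (auto simp: gap_sequences_def gap_dissection_def insert_commute)
  have "\<not> (i < k \<and> k < j \<and> j < l)" "\<not> (k < i \<and> i < l \<and> l < j)"
    using DE(4) unfolding crossing_def D E by blast+
  then consider "j \<le> k" | "l \<le> i" | "i \<le> k" "l \<le> j" | "k \<le> i" "j \<le> l"
    using ij kl by linarith
  then have "\<exists>t r. t \<in> gap_sequences n \<and> S = gap_dissection n t r"
  proof cases
    case 1
    then show ?thesis using disjoint[of i j k l] ij kl by (simp add: S D E)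
  next
    case 2
    then show ?thesis using disjoint[of k l i j] ij kl by (simp add: S D E insert_commute)
  next
    case 3
    then show ?thesis using nested[of i k l j] ij kl ne by (simp add: S D E)
  next
    case 4
    then show ?thesis using nested[of k i j l] ij kl ne by (auto simp add: S D E insert_commute)
  qed
  then show thesis using that by blast
qed

section \<open>Uniqueness of the gap sequence up to \<open>swap_gaps\<close>\<close>

text \<open>The arithmetic core of uniqueness. The residues \<open>y\<close>, \<open>z\<close>,
  \<open>u\<close> are variables with two possible values each, so that every matching of endpoints
  becomes a linear problem. The fourth gap follows from the sum \<open>n\<close>.\<close>

lemma gap_points_eq_imp:
  fixes a b c d :: int
  assumes T: "2 \<le> a" "2 \<le> b" "1 \<le> c + d" "n = a + c + b + d" "0 \<le> c" "0 \<le> d"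
    and T': "2 \<le> a'" "2 \<le> b'" "1 \<le> c' + d'" "n = a' + c' + b' + d'" "0 \<le> c'" "0 \<le> d'"
    and s: "0 \<le> s" "s < n"
    and y: "y = s + a \<or> y = s + a - n" "0 \<le> y" "y < n"
    and z: "z = s + a + c \<or> z = s + a + c - n" "0 \<le> z" "z < n"
    and u: "u = s + a + c + b \<or> u = s + a + c + b - n" "0 \<le> u" "u < n"
    and u': "u' = a' + c' + b' \<and> 1 \<le> d' \<or> u' = 0 \<and> d' = 0"
    and E: "{{s, y}, {z, u}} = {{0, a'}, {a' + c', u'}}"
  shows "a' = a \<and> c' = c \<and> b' = b \<or> a' = b \<and> c' = d \<and> b' = a"
proof -
  consider "{s, y} = {0, a'}" "{z, u} = {a' + c', u'}" | "{s, y} = {a' + c', u'}" "{z, u} = {0, a'}"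
    using E doubleton_eq_iff[of "{s, y}" "{z, u}"] by metis
  then show ?thesis
  proof cases
    case 1
    have "a' = a \<and> c' = c \<and> b' = b"
      using 1[unfolded doubleton_eq_iff] y(1) z(1) u(1) u'
      by (elim disjE conjE; use T T' s y(2,3) z(2,3) u(2,3) in \<open>intro conjI; linarith\<close>)
    then show ?thesis ..
  next
    case 2
    have "a' = b \<and> c' = d \<and> b' = a"
      using 2[unfolded doubleton_eq_iff] y(1) z(1) u(1) u'
      by (elim disjE conjE; use T T' s y(2,3) z(2,3) u(2,3) in \<open>intro conjI; linarith\<close>)
    then show ?thesis ..
  qed
qed

lemma gap_dissection_eq_imp:
  assumes "t \<in> gap_sequences n" "t' \<in> gap_sequences n"
    and eq: "gap_dissection n t r = gap_dissection n t' r'"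
  shows "t' = t \<or> t' = swap_gaps t"
proof -
  obtain a c b d where t: "t = (a, c, b, d)" by (cases t)
  obtain a' c' b' d' where t': "t' = (a', c', b', d')" by (cases t')
  have T: "2 \<le> a" "2 \<le> b" "1 \<le> c + d" "int n = int a + int c + int b + int d"
    and T': "2 \<le> a'" "2 \<le> b'" "1 \<le> c' + d'" "int n = int a' + int c' + int b' + int d'"
    using assms by (auto simp: t t' gap_sequences_def)
  \<comment> \<open>Rotating both dissections by \<open>- r'\<close> moves the start of
    \<open>t'\<close> to \<open>0\<close> and that of \<open>t\<close> to \<open>s\<close>.\<close>
  define s where "s = (r - r') mod int n"
  have n: "0 < int n"
    using T by linarith
  have s: "0 \<le> s" "s < int n"
    using n by (auto simp: s_def)
  \<comment> \<open>Before reduction all endpoints of \<open>t\<close> lie below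
    \<open>2 * int n\<close>, so \<open>n\<close> is subtracted at most once.\<close>
  have wrap: "x mod int n = x \<or> x mod int n = x - int n" if "0 \<le> x" "x < 2 * int n" for x
    using that mod_pos_pos_trivial[of "x - int n" "int n"] by (cases "x < int n") auto
  have "gap_dissection n t s = gap_dissection n t (- r' + r)"
    by (simp add: s_def gap_dissection_mod)
  also have "\<dots> = gap_dissection n t' (- r' + r')"
    by (metis rotate_gap_dissection eq)
  finally have "gap_dissection n t s = gap_dissection n t' 0"
    by simp
  moreover have "int a' mod int n = int a'" "(int a' + int c') mod int n = int a' + int c'"
    using T' by simp_all
  ultimately have E: "{{s, (s + int a) mod int n},
        {(s + int a + int c) mod int n, (s + int a + int c + int b) mod int n}} =
      {{0, int a'}, {int a' + int c', (int a' + int c' + int b') mod int n}}"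
    using s by (simp add: t t' gap_dissection_def)
  have "int a' = int a \<and> int c' = int c \<and> int b' = int b \<or>
      int a' = int b \<and> int c' = int d \<and> int b' = int a"
  proof (rule gap_points_eq_imp[OF _ _ _ T(4) _ _ _ _ _ T'(4) _ _ s _ _ _ _ _ _ _ _ _ _ E])
    show "(int a' + int c' + int b') mod int n = int a' + int c' + int b' \<and> 1 \<le> int d' \<or>
        (int a' + int c' + int b') mod int n = 0 \<and> int d' = 0"
      using T' by (cases "d' = 0") auto
    show "(s + int a) mod int n = s + int a \<or> (s + int a) mod int n = s + int a - int n"
      "(s + int a + int c) mod int n = s + int a + int c \<or>
        (s + int a + int c) mod int n = s + int a + int c - int n"
      "(s + int a + int c + int b) mod int n = s + int a + int c + int b \<or>
        (s + int a + int c + int b) mod int n = s + int a + int c + int b - int n"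
      by (rule wrap; use s T in linarith)+
  qed (use T T' n in auto)
  then show ?thesis using T T' by (auto simp: t t')
qed

section \<open>Orbits as classes of gap sequences\<close>

definition gap_class :: "nat \<Rightarrow> gaps \<Rightarrow> int set set set" where
  "gap_class n t = range (gap_dissection n t)"

lemma gap_class_swap:
  assumes "t \<in> gap_sequences n"
  shows "gap_class n (swap_gaps t) = gap_class n t"
proof -
  have "gap_class n u \<subseteq> gap_class n (swap_gaps u)" if "u \<in> gap_sequences n" for u
    using that gap_dissection_swap[symmetric]
    by (cases u) (force simp: gap_class_def)
  from this[OF assms] this[OF swap_gaps_in[OF assms]] show ?thesis
    by (cases t) auto
qed

lemma gap_class_disjoint:
  assumes "t \<in> gap_sequences n" "t' \<in> gap_sequences n" "gap_dissection n t r \<in> gap_class n t'"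
  shows "t' = t \<or> t' = swap_gaps t"
  using gap_dissection_eq_imp[OF assms(1,2)] assms(3) unfolding gap_class_def by blast

text \<open>Starts matter only modulo \<open>n\<close>, so \<open>n\<close> consecutive shifts reach
  them all.\<close>

lemma rotations_gap_dissection:
  assumes "n > 0"
  shows "(\<lambda>s. gap_dissection n t (s + r)) ` {0..<int n} = gap_class n t"
proof -
  have "gap_dissection n t r' \<in> (\<lambda>s. gap_dissection n t (s + r)) ` {0..<int n}" for r'
  proof (rule image_eqI)
    have "gap_dissection n t ((r' - r) mod int n + r) =
        gap_dissection n t (((r' - r) mod int n + r) mod int n)"
      by (simp only: gap_dissection_mod)
    also have "\<dots> = gap_dissection n t r'"
      by (simp add: mod_simps gap_dissection_mod)
    finally show "gap_dissection n t r' = gap_dissection n t ((r' - r) mod int n + r)" ..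
  qed (use assms in auto)
  then show ?thesis
    by (auto simp: gap_class_def)
qed

lemma cyclic_orbit:
  assumes "n > 0" "t \<in> gap_sequences n"
  shows "orbit (integer_mod_group n) (cyclic_action n 2) (gap_dissection n t r) = gap_class n t"
proof -
  have "orbit (integer_mod_group n) (cyclic_action n 2) (gap_dissection n t r) =
      (\<lambda>s. gap_dissection n t (s + r)) ` {0..<int n}"
    using assms gap_dissection_in_dissections[OF assms]
    by (auto simp: orbit_def carrier_integer_mod_group cyclic_action_def dihedral_action_def
        rotate_gap_dissection)
  then show ?thesis
    using rotations_gap_dissection[OF assms(1)] by simp
qed

text \<open>The first class comes from the rotations, the second from the reflections, whose start
  \<open>s - r - a\<close> still runs through all residues with \<open>s\<close>.\<close>

lemma dihedral_orbit:
  assumes "n > 0" "t \<in> gap_sequences n"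
  shows "orbit (dihedral_group n) (dihedral_action n 2) (gap_dissection n t r) =
    gap_class n t \<union> gap_class n (flip_gaps t)"
proof -
  obtain a c b d where t: "t = (a, c, b, d)" by (cases t)
  have "carrier (dihedral_group n) =
      (\<lambda>s. (s, False)) ` {0..<int n} \<union> (\<lambda>s. (s, True)) ` {0..<int n}"
    by (auto simp: dihedral_group_def)
  then have "orbit (dihedral_group n) (dihedral_action n 2) (gap_dissection n t r) =
      (\<lambda>s. dihedral_action n 2 (s, False) (gap_dissection n t r)) ` {0..<int n} \<union>
      (\<lambda>s. dihedral_action n 2 (s, True) (gap_dissection n t r)) ` {0..<int n}"
    by (auto simp: orbit_def)
  also have "\<dots> = (\<lambda>s. gap_dissection n t (s + r)) ` {0..<int n} \<union>
      (\<lambda>s. gap_dissection n (flip_gaps t) (s + (- r - int a))) ` {0..<int n}"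
    using gap_dissection_in_dissections[OF assms] reflect_gap_dissection[of a c b d n] assms(2)
    by (simp add: dihedral_action_def rotate_gap_dissection t algebra_simps)
  finally show ?thesis
    by (simp only: rotations_gap_dissection[OF assms(1)])
qed

section \<open>Representatives of the orbits\<close>

text \<open>The condition says that \<open>(a, c) \<le> (b, d)\<close> lexicographically. As
  \<open>swap_gaps\<close> exchanges these pairs, \<open>t\<close> or \<open>swap_gaps t\<close>
  qualifies, and both only if they are equal.\<close>

definition cyclic_reps :: "nat \<Rightarrow> gaps set" where
  "cyclic_reps n = {(a, c, b, d) \<in> gap_sequences n. a < b \<or> a = b \<and> c \<le> d}"

text \<open>\<open>swap_gaps\<close> and \<open>flip_gaps\<close> together exchange \<open>a\<close>
  with \<open>b\<close> and \<open>c\<close> with \<open>d\<close> independently, so both pairs can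
  be sorted.\<close>

definition dihedral_reps :: "nat \<Rightarrow> gaps set" where
  "dihedral_reps n = {(a, c, b, d) \<in> gap_sequences n. a \<le> b \<and> c \<le> d}"

lemma orbits_eq_image:
  assumes "n > 0"
    and "\<And>t r. t \<in> gap_sequences n \<Longrightarrow> orbit G \<phi> (gap_dissection n t r) = f t"
  shows "orbits G (dissections n 2) \<phi> = f ` gap_sequences n"
proof (intro equalityI subsetI)
  fix X assume "X \<in> orbits G (dissections n 2) \<phi>"
  then obtain S where "S \<in> dissections n 2" "X = orbit G \<phi> S"
    by (auto simp: orbits_def)
  then show "X \<in> f ` gap_sequences n"
    using assms(2) by (auto elim: dissection_is_gap_dissection)
next
  fix X assume "X \<in> f ` gap_sequences n"
  then obtain t where "t \<in> gap_sequences n" "X = orbit G \<phi> (gap_dissection n t 0)"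
    using assms(2) by auto
  then show "X \<in> orbits G (dissections n 2) \<phi>"
    using gap_dissection_in_dissections[OF assms(1)] unfolding orbits_def by blast
qed

lemma card_cyclic_orbits:
  assumes "n > 0"
  shows "card (orbits (integer_mod_group n) (dissections n 2) (cyclic_action n 2)) =
    card (cyclic_reps n)"
proof -
  have "orbits (integer_mod_group n) (dissections n 2) (cyclic_action n 2) =
      gap_class n ` gap_sequences n"
    using assms by (intro orbits_eq_image cyclic_orbit)
  also have "\<dots> = gap_class n ` cyclic_reps n"
  proof -
    have "gap_class n t \<in> gap_class n ` cyclic_reps n" if "t \<in> gap_sequences n" for t
    proof -
      have "t \<in> cyclic_reps n \<or> swap_gaps t \<in> cyclic_reps n"
        using that by (cases t) (auto simp: cyclic_reps_def gap_sequences_def)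
      then show ?thesis
        using gap_class_swap[OF that] by (metis imageI)
    qed
    then show ?thesis by (auto simp: cyclic_reps_def)
  qed
  moreover have "inj_on (gap_class n) (cyclic_reps n)"
  proof (rule inj_onI)
    fix t t' assume t: "t \<in> cyclic_reps n" "t' \<in> cyclic_reps n" "gap_class n t = gap_class n t'"
    have "gap_dissection n t 0 \<in> gap_class n t'"
      unfolding t(3)[symmetric] by (simp add: gap_class_def)
    with t(1,2) have "t' = t \<or> t' = swap_gaps t"
      by (intro gap_class_disjoint) (auto simp: cyclic_reps_def)
    with t(1,2) show "t = t'"
      by (cases t) (auto simp: cyclic_reps_def)
  qed
  ultimately show ?thesis
    by (simp add: card_image)
qed

lemma card_dihedral_orbits:
  assumes "n > 0"
  shows "card (orbits (dihedral_group n) (dissections n 2) (dihedral_action n 2)) =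
    card (dihedral_reps n)"
proof -
  define f where "f t = gap_class n t \<union> gap_class n (flip_gaps t)" for t
  have "orbits (dihedral_group n) (dissections n 2) (dihedral_action n 2) = f ` gap_sequences n"
    unfolding f_def using assms by (intro orbits_eq_image dihedral_orbit)
  also have "\<dots> = f ` dihedral_reps n"
  proof -
    have flip: "f (flip_gaps t) = f t" for t
      by (cases t) (auto simp: f_def)
    have swap: "f (swap_gaps t) = f t" if "t \<in> gap_sequences n" for t
    proof -
      \<comment> \<open>Flip and swap commute, so the swap invariance of both classes carries over
        to their union.\<close>
      have "flip_gaps (swap_gaps t) = swap_gaps (flip_gaps t)"
        by (cases t) simp
      then show ?thesis
        using gap_class_swap[OF that] gap_class_swap[OF flip_gaps_in[OF that]] by (simp add: f_def)
    qed
    have "f t \<in> f ` dihedral_reps n" if "t \<in> gap_sequences n" for t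
    proof -
      have "t \<in> dihedral_reps n \<or> swap_gaps t \<in> dihedral_reps n \<or> flip_gaps t \<in> dihedral_reps n \<or>
          flip_gaps (swap_gaps t) \<in> dihedral_reps n"
        using that by (cases t) (auto simp: dihedral_reps_def gap_sequences_def)
      then show ?thesis
        using swap[OF that] flip by (metis imageI)
    qed
    then show ?thesis by (auto simp: dihedral_reps_def)
  qed
  moreover have "inj_on f (dihedral_reps n)"
  proof (rule inj_onI)
    fix t t' assume t: "t \<in> dihedral_reps n" "t' \<in> dihedral_reps n" "f t = f t'"
    have T: "t \<in> gap_sequences n" "t' \<in> gap_sequences n"
      using t by (auto simp: dihedral_reps_def)
    have "gap_dissection n t 0 \<in> f t'"
      unfolding t(3)[symmetric] by (simp add: f_def gap_class_def)
    \<comment> \<open>The two classes making up \<open>f t'\<close> leave four candidates; sorting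
      both pairs makes them coincide.\<close>
    then have "t' = t \<or> t' = swap_gaps t \<or> flip_gaps t' = t \<or> flip_gaps t' = swap_gaps t"
      using gap_class_disjoint T flip_gaps_in[OF T(2)] unfolding f_def by blast
    with t(1,2) show "t = t'"
      by (cases t; cases t') (auto simp: dihedral_reps_def)
  qed
  ultimately show ?thesis
    by (simp add: card_image)
qed

section \<open>Counting representatives by \<open>a + b\<close>\<close>

text \<open>Here \<open>m = a + b\<close>, which is below \<open>n\<close> because
  \<open>c + d\<close> is positive; then \<open>a\<close> is at most half of \<open>m\<close> and
  \<open>c\<close> at most half of \<open>n - m\<close>, independently.\<close>

lemma card_dihedral_reps:
  "card (dihedral_reps n) = (\<Sum>m\<in>{4..<n}. (m div 2 - 1) * ((n - m) div 2 + 1))"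
proof -
  let ?A = "SIGMA m:{4..<n}. {2..m div 2} \<times> {0..(n - m) div 2}"
  have "bij_betw (\<lambda>(a, c, b, d). (a + b, a, c)) (dihedral_reps n) ?A"
    by (rule bij_betw_byWitness[where f' = "\<lambda>(m, a, c). (a, c, m - a, n - m - c)"])
      (auto simp: dihedral_reps_def gap_sequences_def)
  then have "card (dihedral_reps n) = card ?A"
    by (rule bij_betw_same_card)
  also have "\<dots> = (\<Sum>m\<in>{4..<n}. (m div 2 - 1) * ((n - m) div 2 + 1))"
    by (subst card_SigmaI) (auto simp: card_cartesian_product intro!: sum.cong)
  finally show ?thesis .
qed

text \<open>The first sum counts \<open>a < b\<close> by \<open>m = a + b\<close>, with
  \<open>c\<close> free in \<open>{0..n - m}\<close>; the second counts \<open>a = b\<close>, where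
  \<open>c\<close> is at most half of \<open>n - 2 * a\<close>.\<close>

lemma card_cyclic_reps:
  "card (cyclic_reps n) = (\<Sum>m\<in>{4..<n}. ((m - 1) div 2 - 1) * (n - m + 1)) +
    (\<Sum>a\<in>{2..(n - 1) div 2}. (n - 2 * a) div 2 + 1)"
proof -
  let ?A = "SIGMA m:{4..<n}. {2..(m - 1) div 2} \<times> {0..n - m}"
  let ?B = "SIGMA a:{2..(n - 1) div 2}. {0..(n - 2 * a) div 2}"
  let ?X = "{(a, c, b, d) \<in> gap_sequences n. a < b}"
  let ?Y = "{(a, c, b, d) \<in> gap_sequences n. a = b \<and> c \<le> d}"
  have X: "bij_betw (\<lambda>(a, c, b, d). (a + b, a, c)) ?X ?A"
    by (rule bij_betw_byWitness[where f' = "\<lambda>(m, a, c). (a, c, m - a, n - m - c)"])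
      (auto simp: gap_sequences_def)
  have Y: "bij_betw (\<lambda>(a, c, b, d). (a, c)) ?Y ?B"
    by (rule bij_betw_byWitness[where f' = "\<lambda>(a, c). (a, c, a, n - 2 * a - c)"])
      (auto simp: gap_sequences_def)
  have fin: "finite ?X" "finite ?Y"
    using bij_betw_finite[OF X] bij_betw_finite[OF Y] by simp_all
  have "cyclic_reps n = ?X \<union> ?Y" "?X \<inter> ?Y = {}"
    by (auto simp: cyclic_reps_def)
  then have "card (cyclic_reps n) = card ?X + card ?Y"
    using card_Un_disjoint[OF fin] by simp
  also have "card ?X = (\<Sum>m\<in>{4..<n}. ((m - 1) div 2 - 1) * (n - m + 1))"
    unfolding bij_betw_same_card[OF X]
    by (subst card_SigmaI) (auto simp: card_cartesian_product intro!: sum.cong)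
  also have "card ?Y = (\<Sum>a\<in>{2..(n - 1) div 2}. (n - 2 * a) div 2 + 1)"
    unfolding bij_betw_same_card[OF Y] by (subst card_SigmaI) auto
  finally show ?thesis .
qed

section \<open>Closed forms of the counting sums\<close>

text \<open>Pairing the neighbours \<open>2 * j\<close> and \<open>2 * j + 1\<close> removes the
  rounding of \<open>div 2\<close>.\<close>

lemma sum_pairs:
  fixes f :: "nat \<Rightarrow> 'a :: comm_monoid_add"
  shows "(\<Sum>m\<in>{2 * l..<2 * k}. f m) = (\<Sum>j\<in>{l..<k}. f (2 * j) + f (2 * j + 1))"
proof (induction k)
  case (Suc k)
  then show ?case
    by (cases "l \<le> k") (auto simp: ac_simps)
qed simp

text \<open>When each pair of terms is a quadratic polynomial in \<open>j = i + 2\<close>, the power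
  sums from \<open>2\<close> to \<open>k - 1\<close> apply. The slack \<open>l\<close> turns
  truncated subtractions such as \<open>k - j\<close> into additions.\<close>

lemma sum_pairs_quadratic:
  fixes f :: "nat \<Rightarrow> nat"
  assumes "2 \<le> k"
    and f: "\<And>i l. k = i + l + 3 \<Longrightarrow> real (f (2 * i + 4)) + real (f (2 * i + 5)) =
      x + y * (real i + 2) + z * (real i + 2)\<^sup>2"
  shows "real (\<Sum>m\<in>{4..<2 * k}. f m) =
    x * (real k - 2) + y * ((real k)\<^sup>2 - real k - 2) / 2 +
    z * (real k * (real k - 1) * (2 * real k - 1) / 6 - 1)"
proof -
  have "real (\<Sum>m\<in>{4..<2 * k}. f m) = (\<Sum>j\<in>{2..<k}. real (f (2 * j)) + real (f (2 * j + 1)))"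
    using sum_pairs[of f 2 k] by simp
  also have "\<dots> = (\<Sum>j\<in>{2..<k}. x + y * real j + z * (real j)\<^sup>2)"
  proof (rule sum.cong)
    fix j assume "j \<in> {2..<k}"
    then obtain i l where "j = i + 2" "k = i + l + 3"
      using le_Suc_ex[of 2 j] less_imp_Suc_add[of j k] by auto
    moreover from this have "2 * j = 2 * i + 4" "2 * j + 1 = 2 * i + 5" "real j = real i + 2"
      by simp_all
    ultimately show "real (f (2 * j)) + real (f (2 * j + 1)) = x + y * real j + z * (real j)\<^sup>2"
      using f[of i l] by (simp only:)
  qed simp
  also have "\<dots> = x * (real k - 2) + y * ((real k)\<^sup>2 - real k - 2) / 2 +
      z * (real k * (real k - 1) * (2 * real k - 1) / 6 - 1)"
    using assms(1)
    by (induction k rule: dec_induct) (simp_all add: field_simps power2_eq_square)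
  finally show ?thesis .
qed

lemma real_card_dihedral_reps_even:
  assumes "2 \<le> k"
  shows "24 * real (card (dihedral_reps (2 * k))) =
    (2 * real k - 4) * (2 * real k - 2) * (2 * real k + 3)"
  unfolding card_dihedral_reps
  \<comment> \<open>The coefficients expand \<open>(j - 1) * (2 * k - 2 * j + 1)\<close>, the sum of
    the terms at \<open>2 * j\<close> and \<open>2 * j + 1\<close>.\<close>
  by (subst sum_pairs_quadratic[OF assms, where x = "- (2 * real k + 1)"
        and y = "2 * real k + 3" and z = "- 2"])
    (simp_all add: field_simps power2_eq_square)

lemma real_card_dihedral_reps_odd:
  assumes "2 \<le> k"
  shows "24 * real (card (dihedral_reps (2 * k + 1))) =
    (2 * real k - 2) * ((2 * real k + 1)\<^sup>2 - 13)"
proof -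
  let ?f = "\<lambda>m. (m div 2 - 1) * ((2 * k + 1 - m) div 2 + 1)"
  \<comment> \<open>The range ends at \<open>2 * k\<close>, whose term has no partner and is split
    off; each pair contributes \<open>2 * (j - 1) * (k - j + 1)\<close>.\<close>
  have "card (dihedral_reps (2 * k + 1)) = (\<Sum>m\<in>{4..<2 * k}. ?f m) + ?f (2 * k)"
    using assms
    by (simp only: card_dihedral_reps Suc_eq_plus1[symmetric]) (subst sum.atLeastLessThan_Suc, auto)
  moreover have "real (?f (2 * k)) = real k - 1"
    using assms by simp
  moreover have "real (\<Sum>m\<in>{4..<2 * k}. ?f m) = - 2 * (real k + 1) * (real k - 2) +
      2 * (real k + 2) * ((real k)\<^sup>2 - real k - 2) / 2 +
      - 2 * (real k * (real k - 1) * (2 * real k - 1) / 6 - 1)"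
    by (rule sum_pairs_quadratic[OF assms]) (simp add: field_simps power2_eq_square)
  ultimately have "real (card (dihedral_reps (2 * k + 1))) = - 2 * (real k + 1) * (real k - 2) +
      2 * (real k + 2) * ((real k)\<^sup>2 - real k - 2) / 2 +
      - 2 * (real k * (real k - 1) * (2 * real k - 1) / 6 - 1) + (real k - 1)"
    by (simp only: of_nat_add)
  then show ?thesis
    by (simp add: field_simps power2_eq_square)
qed

lemma real_card_cyclic_reps_even:
  assumes "2 \<le> k"
  shows "12 * real (card (cyclic_reps (2 * k))) = 2 * real k * (2 * real k - 2) * (2 * real k - 4)"
proof -
  let ?f = "\<lambda>m. ((m - 1) div 2 - 1) * (2 * k - m + 1)"
  \<comment> \<open>A pair contributes
    \<open>(j - 2) * (2 * k - 2 * j + 1) + (j - 1) * (2 * k - 2 * j)\<close>.\<close>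
  have "real (\<Sum>m\<in>{4..<2 * k}. ?f m) = - (6 * real k + 2) * (real k - 2) +
      (4 * real k + 7) * ((real k)\<^sup>2 - real k - 2) / 2 +
      - 4 * (real k * (real k - 1) * (2 * real k - 1) / 6 - 1)"
    by (rule sum_pairs_quadratic[OF assms]) (simp add: field_simps power2_eq_square)
  \<comment> \<open>The summand equals \<open>k + 1 - a\<close>, which reverses the range.\<close>
  moreover have "(\<Sum>a\<in>{2..(2 * k - 1) div 2}. (2 * k - 2 * a) div 2 + 1) = (\<Sum>a\<in>{2..<k}. a)"
    by (rule sum.reindex_bij_witness[where i = "\<lambda>a. k + 1 - a" and j = "\<lambda>a. k + 1 - a"])
      (use assms in auto)
  moreover have "real (\<Sum>a\<in>{2..<k}. a) = (real k * (real k - 1)) / 2 - 1"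
    using assms by (induction k rule: dec_induct) (simp_all add: field_simps)
  ultimately have "real (card (cyclic_reps (2 * k))) = - (6 * real k + 2) * (real k - 2) +
      (4 * real k + 7) * ((real k)\<^sup>2 - real k - 2) / 2 +
      - 4 * (real k * (real k - 1) * (2 * real k - 1) / 6 - 1) + ((real k * (real k - 1)) / 2 - 1)"
    by (simp only: of_nat_add card_cyclic_reps)
  then show ?thesis
    by (simp add: field_simps power2_eq_square)
qed

lemma real_card_cyclic_reps_odd:
  assumes "2 \<le> k"
  shows "12 * real (card (cyclic_reps (2 * k + 1))) =
    (2 * real k + 2) * (2 * real k - 2) * (2 * real k - 3)"
proof -
  let ?f = "\<lambda>m. ((m - 1) div 2 - 1) * (2 * k + 1 - m + 1)"
  have "(\<Sum>m\<in>{4..<2 * k + 1}. ?f m) = (\<Sum>m\<in>{4..<2 * k}. ?f m) + ?f (2 * k)"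
    using assms by (simp only: Suc_eq_plus1[symmetric]) (subst sum.atLeastLessThan_Suc, auto)
  moreover have "real (?f (2 * k)) = 2 * real k - 4"
  proof -
    obtain l where "k = l + 2" using le_Suc_ex[OF assms] by auto
    then show ?thesis by simp
  qed
  \<comment> \<open>A pair contributes \<open>(j - 2) * (2 * k - 2 * j + 2) + (j - 1) * (2 * k - 2 *
    j + 1)\<close>.\<close>
  moreover have "real (\<Sum>m\<in>{4..<2 * k}. ?f m) = - (6 * real k + 5) * (real k - 2) +
      (4 * real k + 9) * ((real k)\<^sup>2 - real k - 2) / 2 +
      - 4 * (real k * (real k - 1) * (2 * real k - 1) / 6 - 1)"
    by (rule sum_pairs_quadratic[OF assms]) (simp add: field_simps power2_eq_square)
  \<comment> \<open>Now \<open>a\<close> runs up to \<open>k\<close>, so the reversed range starts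
    at \<open>1\<close>.\<close>
  moreover have "(\<Sum>a\<in>{2..(2 * k + 1 - 1) div 2}. (2 * k + 1 - 2 * a) div 2 + 1) =
      (\<Sum>a\<in>{1..<k}. a)"
    by (rule sum.reindex_bij_witness[where i = "\<lambda>a. k + 1 - a" and j = "\<lambda>a. k + 1 - a"])
      (use assms in auto)
  moreover have "real (\<Sum>a\<in>{1..<k}. a) = (real k * (real k - 1)) / 2"
    using assms by (induction k rule: dec_induct) (simp_all add: field_simps numeral_2_eq_2)
  ultimately have "real (card (cyclic_reps (2 * k + 1))) = - (6 * real k + 5) * (real k - 2) +
      (4 * real k + 9) * ((real k)\<^sup>2 - real k - 2) / 2 +
      - 4 * (real k * (real k - 1) * (2 * real k - 1) / 6 - 1) + (2 * real k - 4) +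
      ((real k * (real k - 1)) / 2)"
    by (simp only: of_nat_add card_cyclic_reps)
  then show ?thesis
    by (simp add: field_simps power2_eq_square)
qed

theorem theorem5:
  fixes n :: nat
  assumes "n \<ge> 2"
  shows "real (card (orbits (integer_mod_group n) (dissections n 2) (cyclic_action n 2))) =
      (if even n then 1 / 12 * real n * (real n - 2) * (real n - 4)
       else 1 / 12 * (real n + 1) * (real n - 3) * (real n - 4))
    \<and> real (card (orbits (dihedral_group n) (dissections n 2) (dihedral_action n 2))) =
      (if even n then 1 / 24 * (real n - 4) * (real n - 2) * (real n + 3)
       else 1 / 24 * (real n - 3) * ((real n)\<^sup>2 - 13))"
proof -
  have "0 < n" using assms by simp
  note card = card_cyclic_orbits[OF this] card_dihedral_orbits[OF this]
  \<comment> \<open>For \<open>n < 4\<close> there are no gap sequences and the formulas vanish; the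
    closed forms assume \<open>2 \<le> k\<close>.\<close>
  consider "n = 2" | "n = 3" | k where "n = 2 * k" "2 \<le> k" | k where "n = 2 * k + 1" "2 \<le> k"
  proof (cases "n < 4")
    case True
    then show thesis using assms that by linarith
  next
    case False
    then have "n = 2 * (n div 2) \<or> n = 2 * (n div 2) + 1" "2 \<le> n div 2"
      by linarith+
    then show thesis using that by blast
  qed
  then show ?thesis
  proof cases
    case 1
    then have "cyclic_reps n = {}" "dihedral_reps n = {}"
      by (auto simp: cyclic_reps_def dihedral_reps_def gap_sequences_def)
    with 1 show ?thesis unfolding card by simp
  next
    case 2
    then have "cyclic_reps n = {}" "dihedral_reps n = {}"
      by (auto simp: cyclic_reps_def dihedral_reps_def gap_sequences_def)
    with 2 show ?thesis unfolding card by simp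
  next
    case (3 k)
    then show ?thesis
      unfolding card using real_card_cyclic_reps_even[of k] real_card_dihedral_reps_even[of k] by simp
  next
    case (4 k)
    then show ?thesis
      unfolding card using real_card_cyclic_reps_odd[of k] real_card_dihedral_reps_odd[of k]
      by (simp add: ac_simps)
  qed
qed

end
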